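(* BIM-SDP is exact if and only if BFM-SDP is exact. That is: every optimal solution $(s,v,W)$ of BIM-SDP satisfies $$\operatorname{rank}\begin{bmatrix} v_i^{\Phi_{ij}} & W_{ij}\\ W_{ji} & v_j\end{bmatrix}=1\quad\text{for all } i\rightarrow j$$ if and only if every optimal solution $(s,v,S,\ell)$ of BFM-SDP satisfies $$\operatorname{rank}\begin{bmatrix} v_i^{\Phi_{ij}} & S_{ij}\\ S_{ij}^H & \ell_{ij}\end{bmatrix}=1\quad\text{for all } i\rightarrow j.$$
   Context: Network. A multiphase radial network is a tree (connected) with bus set $\mathcal N=\{0,1,\dots,n\}$, where $0$ is the substation bus, and $\mathcal N^+=\mathcal N\setminus\{0\}$. Lines form a set $\mathcal E$ of ordered pairs $(i,j)$ such that $i$ lies between bus $0$ and $j$ (i.e. edges are oriented away from bus $0$). Write $i\rightarrow j$ for $(i,j)\in\mathcal E$, and $i\sim j$ if $i\rightarrow j$ or $j\rightarrow i$. Bus $i$ has phase set $\Phi_i\subseteq\{a,b,c\}$, line $i\sim j$ has phase set $\Phi_{ij}=\Phi_{ji}$, and $\Phi_i\supseteq\Phi_{ij}=\Phi_j$ for $i\rightarrow j$. Each line $i\sim j$ has an invertible impedance matrix $z_{ij}=z_{ji}\in\mathbb C^{|\Phi_{ij}|\times|\Phi_{ij}|}$, and $y_{ij}=z_{ij}^{-1}$. Notation. $|A|$ is the number of elements of a set $A$. Vectors and matrices attached to a bus or line are indexed by its phases. A superscript phase set denotes restriction to those phases (for a matrix, the principal submatrix), and, when the superscript set is larger than the set of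 phases present, extension by zeros in the missing phases. $\operatorname{diag}(M)$ is the vector of diagonal entries of the matrix $M$, $^H$ is conjugate transpose, $\mathbb H^{k\times k}$ is the set of $k\times k$ complex Hermitian matrices, $A\succeq0$ means Hermitian positive semidefinite; vector inequalities are componentwise. Data. Cost functions $C_i:\mathbb C^{|\Phi_i|}\to\mathbb R$ ($i\in\mathcal N$); sets $\mathcal S_i\subseteq\mathbb C^{|\Phi_i|}$ ($i\in\mathcal N^+$), not necessarily convex; $V_0^{\rm ref}\in\mathbb C^{|\Phi_0|}$ with all components nonzero; voltage ranges $[\underline V_i^\phi,\overline V_i^\phi]$ with $\underline V_i^\phi>0$ for $i\in\mathcal N^+,\phi\in\Phi_i$; $\underline v_i=[(\underline V_i^\phi)^2]_{\phi\in\Phi_i}$, $\overline v_i=[(\overline V_i^\phi)^2]_{\phi\in\Phi_i}$. BIM-SDP: minimize $\sum_{i\in\mathcal N}C_i(s_i)$ over $(s,v,W)$ with $s_i\in\mathbb C^{|\Phi_i|}$, $v_i\in\mathbb H^{|\Phi_i|\times|\Phi_i|}$ ($i\in\mathcal N$), $W_{ij}\in\mathbb C^{|\Phi_{ij}|\times|\Phi_{ij}|}$ ($i\sim j$), subject to (i) $s_i=\sum_{j:\,i\sim j}\operatorname{diag}[(v_i^{\Phi_{ij}}-W_{ij})y_{ij}^H]^{\Phi_i}$, $i\in\mathcal N$; (ii) $s_i\in\mathcal S_i$, $i\in\mathcal N^+$; (iii) $v_0=V_0^{\rm ref}(V_0^{\rm ref})^H$; (iv) $\underline v_i\le\operatorname{diag}(v_i)\le\overline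 v_i$, $i\in\mathcal N^+$; (v) $W_{ij}=W_{ji}^H$, $i\rightarrow j$; (vi) $\begin{bmatrix} v_i^{\Phi_{ij}} & W_{ij}\\ W_{ji} & v_j\end{bmatrix}\succeq0$, $i\rightarrow j$. BFM-SDP: minimize $\sum_{i\in\mathcal N}C_i(s_i)$ over $(s,v,S,\ell)$ with $s_i\in\mathbb C^{|\Phi_i|}$, $v_i\in\mathbb H^{|\Phi_i|\times|\Phi_i|}$ ($i\in\mathcal N$), $S_{ij}\in\mathbb C^{|\Phi_{ij}|\times|\Phi_{ij}|}$, $\ell_{ij}\in\mathbb H^{|\Phi_{ij}|\times|\Phi_{ij}|}$ ($i\rightarrow j$), subject to (i') $\sum_{i:\,i\rightarrow j}\operatorname{diag}(S_{ij}-z_{ij}\ell_{ij})+s_j=\sum_{k:\,j\rightarrow k}\operatorname{diag}(S_{jk})^{\Phi_j}$, $j\in\mathcal N$; (ii') $s_i\in\mathcal S_i$, $i\in\mathcal N^+$; (iii') $v_0=V_0^{\rm ref}(V_0^{\rm ref})^H$; (iv') $\underline v_i\le\operatorname{diag}(v_i)\le\overline v_i$, $i\in\mathcal N^+$; (v') $v_j=v_i^{\Phi_{ij}}-(S_{ij}z_{ij}^H+z_{ij}S_{ij}^H)+z_{ij}\ell_{ij}z_{ij}^H$, $i\rightarrow j$; (vi') $\begin{bmatrix} v_i^{\Phi_{ij}} & S_{ij}\\ S_{ij}^H & \ell_{ij}\end{bmatrix}\succeq0$, $i\rightarrow j$. *)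

theory Defs
  imports "HOL-Analysis.Analysis"
begin

section \<open>Phase-indexed vectors and matrices\<close>

datatype phase = phase_a | phase_b | phase_c

instance phase :: finite
proof
  have "(UNIV :: phase set) = {phase_a, phase_b, phase_c}"
    using phase.exhaust by blast
  then show "finite (UNIV :: phase set)"
    by (metis finite.emptyI finite.insertI)
qed

text \<open>
  A vector in \<open>\<complex>\<^bsup>|\<Phi>|\<^esup>\<close> is an element of \<^typ>\<open>complex^phase\<close> that vanishes outside \<open>\<Phi>\<close>, and a
  \<open>|\<Phi>| \<times> |\<Phi>|\<close> matrix is an element of \<^typ>\<open>complex^phase^phase\<close> that vanishes outside \<open>\<Phi> \<times> \<Phi>\<close>.
  The zero rows and columns affect neither sums, products and adjoints, nor the rank, nor
  positive semidefiniteness.  Only inversion needs care: it is relative to the identity on \<open>\<Phi>\<close>.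
\<close>

type_synonym cvec = "complex^phase"
type_synonym cmat = "complex^phase^phase"

definition phase_vecs :: "phase set \<Rightarrow> cvec set" where
  "phase_vecs \<Phi> = {x. \<forall>\<phi>. \<phi> \<notin> \<Phi> \<longrightarrow> x $ \<phi> = 0}"

definition phase_mats :: "phase set \<Rightarrow> cmat set" where
  "phase_mats \<Phi> = {A. \<forall>\<phi> \<psi>. \<not> (\<phi> \<in> \<Phi> \<and> \<psi> \<in> \<Phi>) \<longrightarrow> A $ \<phi> $ \<psi> = 0}"

text \<open>
  The superscript \<open>\<Phi>\<close> on vectors and matrices: entries outside \<open>\<Phi>\<close> are dropped, and phases of
  \<open>\<Phi>\<close> that are not present in the argument carry the entry 0 already.
\<close>

definition vec_sup :: "cvec \<Rightarrow> phase set \<Rightarrow> cvec" where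
  "vec_sup x \<Phi> = (\<chi> \<phi>. if \<phi> \<in> \<Phi> then x $ \<phi> else 0)"

definition mat_sup :: "cmat \<Rightarrow> phase set \<Rightarrow> cmat" where
  "mat_sup A \<Phi> = (\<chi> \<phi> \<psi>. if \<phi> \<in> \<Phi> \<and> \<psi> \<in> \<Phi> then A $ \<phi> $ \<psi> else 0)"

definition phase_id :: "phase set \<Rightarrow> cmat" where
  "phase_id \<Phi> = mat_sup (mat 1) \<Phi>"

definition is_phase_inv :: "phase set \<Rightarrow> cmat \<Rightarrow> cmat \<Rightarrow> bool" where
  "is_phase_inv \<Phi> A B \<longleftrightarrow> B \<in> phase_mats \<Phi> \<and> A ** B = phase_id \<Phi> \<and> B ** A = phase_id \<Phi>"

definition phase_invertible :: "phase set \<Rightarrow> cmat \<Rightarrow> bool" where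
  "phase_invertible \<Phi> A \<longleftrightarrow> (\<exists>B. is_phase_inv \<Phi> A B)"

definition phase_inv :: "phase set \<Rightarrow> cmat \<Rightarrow> cmat" where
  "phase_inv \<Phi> A = (THE B. is_phase_inv \<Phi> A B)"

definition diag_vec :: "'a^'n^'n \<Rightarrow> 'a^'n" where
  "diag_vec A = (\<chi> i. A $ i $ i)"

definition adj_mat :: "complex^'n^'m \<Rightarrow> complex^'m^'n" where
  "adj_mat A = map_matrix cnj (transpose A)"

definition outer_self :: "complex^'n \<Rightarrow> complex^'n^'n" where
  "outer_self x = (\<chi> i j. x $ i * cnj (x $ j))"

definition hermitian :: "complex^'n^'n \<Rightarrow> bool" where
  "hermitian A \<longleftrightarrow> adj_mat A = A"

definition psd :: "complex^'n^'n \<Rightarrow> bool" where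
  "psd A \<longleftrightarrow> hermitian A \<and> (\<forall>x. 0 \<le> Re (\<Sum>i\<in>UNIV. cnj (x $ i) * (A *v x) $ i))"

definition herm_mats :: "phase set \<Rightarrow> cmat set" where
  "herm_mats \<Phi> = {A \<in> phase_mats \<Phi>. hermitian A}"

definition block :: "'a^'n^'n \<Rightarrow> 'a^'n^'n \<Rightarrow> 'a^'n^'n \<Rightarrow> 'a^'n^'n \<Rightarrow> 'a^('n + 'n)^('n + 'n)" where
  "block A B C D = (\<chi> r c. case r of
      Inl i \<Rightarrow> (case c of Inl j \<Rightarrow> A $ i $ j | Inr j \<Rightarrow> B $ i $ j)
    | Inr i \<Rightarrow> (case c of Inl j \<Rightarrow> C $ i $ j | Inr j \<Rightarrow> D $ i $ j))"


section \<open>Trees rooted at bus 0\<close>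

definition adjacent :: "(nat \<times> nat) set \<Rightarrow> nat \<Rightarrow> nat \<Rightarrow> bool" where
  "adjacent E i j \<longleftrightarrow> (i, j) \<in> E \<or> (j, i) \<in> E"

definition simple_path :: "nat set \<Rightarrow> (nat \<times> nat) set \<Rightarrow> nat list \<Rightarrow> bool" where
  "simple_path N E p \<longleftrightarrow>
     p \<noteq> [] \<and> set p \<subseteq> N \<and> distinct p \<and> successively (adjacent E) p"

definition path_between :: "nat set \<Rightarrow> (nat \<times> nat) set \<Rightarrow> nat \<Rightarrow> nat list \<Rightarrow> nat \<Rightarrow> bool" where
  "path_between N E i p j \<longleftrightarrow> simple_path N E p \<and> hd p = i \<and> last p = j"

definition undirected_cycle :: "nat set \<Rightarrow> (nat \<times> nat) set \<Rightarrow> nat list \<Rightarrow> bool" where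
  "undirected_cycle N E p \<longleftrightarrow> simple_path N E p \<and> 3 \<le> length p \<and> adjacent E (last p) (hd p)"

text \<open>
  \<open>E\<close> lists the edges of an undirected tree on \<open>N\<close>; loops are excluded by the first clause.
\<close>

definition is_tree :: "nat set \<Rightarrow> (nat \<times> nat) set \<Rightarrow> bool" where
  "is_tree N E \<longleftrightarrow>
     E \<subseteq> N \<times> N \<and> (\<forall>i. (i, i) \<notin> E) \<and>
     (\<forall>i\<in>N. \<forall>j\<in>N. \<exists>p. path_between N E i p j) \<and>
     (\<nexists>p. undirected_cycle N E p)"

text \<open>
  Every line \<open>(i, j)\<close> has \<open>i\<close> on the (in a tree, unique) path from bus 0 to \<open>j\<close>.
\<close>

definition oriented_from_root :: "nat set \<Rightarrow> (nat \<times> nat) set \<Rightarrow> bool" where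
  "oriented_from_root N E \<longleftrightarrow>
     (\<forall>(i, j)\<in>E. \<forall>p. path_between N E 0 p j \<longrightarrow> i \<in> set p)"


section \<open>Multiphase radial networks and the data of the optimal power flow problem\<close>

text \<open>
  Fields indexed by buses (lines) are meaningful only on the bus set (on adjacent pairs of buses);
  \<open>cost i\<close> is meaningful only on \<open>phase_vecs (bphases P i)\<close>.
\<close>

record multiphase_opf =
  nbus :: nat
  lines :: "(nat \<times> nat) set"
  bphases :: "nat \<Rightarrow> phase set"
  lphases :: "nat \<Rightarrow> nat \<Rightarrow> phase set"
  impedance :: "nat \<Rightarrow> nat \<Rightarrow> cmat"
  cost :: "nat \<Rightarrow> cvec \<Rightarrow> real"
  injections :: "nat \<Rightarrow> cvec set"
  V0ref :: cvec
  Vmin :: "nat \<Rightarrow> phase \<Rightarrow> real"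
  Vmax :: "nat \<Rightarrow> phase \<Rightarrow> real"

definition buses :: "multiphase_opf \<Rightarrow> nat set" where
  "buses P = {0..nbus P}"

definition buses_pos :: "multiphase_opf \<Rightarrow> nat set" where
  "buses_pos P = buses P - {0}"

definition admittance :: "multiphase_opf \<Rightarrow> nat \<Rightarrow> nat \<Rightarrow> cmat" where
  "admittance P i j = phase_inv (lphases P i j) (impedance P i j)"

definition multiphase_radial_network :: "multiphase_opf \<Rightarrow> bool" where
  "multiphase_radial_network P \<longleftrightarrow>
     is_tree (buses P) (lines P) \<and>
     oriented_from_root (buses P) (lines P) \<and>
     (\<forall>(i, j)\<in>lines P.
        lphases P i j = lphases P j i \<and>
        lphases P i j \<subseteq> bphases P i \<and>
        lphases P i j = bphases P j \<and>
        impedance P i j = impedance P j i \<and>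
        impedance P i j \<in> phase_mats (lphases P i j) \<and>
        phase_invertible (lphases P i j) (impedance P i j))"

definition opf_data :: "multiphase_opf \<Rightarrow> bool" where
  "opf_data P \<longleftrightarrow>
     (\<forall>i\<in>buses_pos P. injections P i \<subseteq> phase_vecs (bphases P i)) \<and>
     V0ref P \<in> phase_vecs (bphases P 0) \<and>
     (\<forall>\<phi>\<in>bphases P 0. V0ref P $ \<phi> \<noteq> 0) \<and>
     (\<forall>i\<in>buses_pos P. \<forall>\<phi>\<in>bphases P i. 0 < Vmin P i \<phi>)"

definition total_cost :: "multiphase_opf \<Rightarrow> (nat \<Rightarrow> cvec) \<Rightarrow> real" where
  "total_cost P s = (\<Sum>i\<in>buses P. cost P i (s i))"

text \<open>
  \<open>v i\<close> is Hermitian, so its diagonal is real and \<^const>\<open>Re\<close> loses nothing.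
\<close>

definition voltage_bounds :: "multiphase_opf \<Rightarrow> (nat \<Rightarrow> cmat) \<Rightarrow> bool" where
  "voltage_bounds P v \<longleftrightarrow>
     (\<forall>i\<in>buses_pos P. \<forall>\<phi>\<in>bphases P i.
        (Vmin P i \<phi>)\<^sup>2 \<le> Re (diag_vec (v i) $ \<phi>) \<and> Re (diag_vec (v i) $ \<phi>) \<le> (Vmax P i \<phi>)\<^sup>2)"


section \<open>The two semidefinite relaxations\<close>

text \<open>
  The decision variables are families indexed by buses or by lines; their values at other indices
  are irrelevant: no constraint, objective or rank condition mentions them.
\<close>

definition bim_block ::
  "multiphase_opf \<Rightarrow> (nat \<Rightarrow> cmat) \<Rightarrow> (nat \<Rightarrow> nat \<Rightarrow> cmat) \<Rightarrow> nat \<Rightarrow> nat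
     \<Rightarrow> complex^(phase + phase)^(phase + phase)" where
  "bim_block P v W i j = block (mat_sup (v i) (lphases P i j)) (W i j) (W j i) (v j)"

definition bim_feasible ::
  "multiphase_opf \<Rightarrow> (nat \<Rightarrow> cvec) \<Rightarrow> (nat \<Rightarrow> cmat) \<Rightarrow> (nat \<Rightarrow> nat \<Rightarrow> cmat) \<Rightarrow> bool" where
  "bim_feasible P s v W \<longleftrightarrow>
     (\<forall>i\<in>buses P. s i \<in> phase_vecs (bphases P i)) \<and>
     (\<forall>i\<in>buses P. v i \<in> herm_mats (bphases P i)) \<and>
     (\<forall>i j. adjacent (lines P) i j \<longrightarrow> W i j \<in> phase_mats (lphases P i j)) \<and>
     (\<forall>i\<in>buses P. s i =
        (\<Sum>j | adjacent (lines P) i j.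
           vec_sup (diag_vec ((mat_sup (v i) (lphases P i j) - W i j) ** adj_mat (admittance P i j)))
             (bphases P i))) \<and>
     (\<forall>i\<in>buses_pos P. s i \<in> injections P i) \<and>
     v 0 = outer_self (V0ref P) \<and>
     voltage_bounds P v \<and>
     (\<forall>(i, j)\<in>lines P. W i j = adj_mat (W j i)) \<and>
     (\<forall>(i, j)\<in>lines P. psd (bim_block P v W i j))"

definition bim_optimal ::
  "multiphase_opf \<Rightarrow> (nat \<Rightarrow> cvec) \<Rightarrow> (nat \<Rightarrow> cmat) \<Rightarrow> (nat \<Rightarrow> nat \<Rightarrow> cmat) \<Rightarrow> bool" where
  "bim_optimal P s v W \<longleftrightarrow>
     bim_feasible P s v W \<and>
     (\<forall>s' v' W'. bim_feasible P s' v' W' \<longrightarrow> total_cost P s \<le> total_cost P s')"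

definition bim_sdp_exact :: "multiphase_opf \<Rightarrow> bool" where
  "bim_sdp_exact P \<longleftrightarrow>
     (\<forall>s v W. bim_optimal P s v W \<longrightarrow> (\<forall>(i, j)\<in>lines P. rank (bim_block P v W i j) = 1))"

definition bfm_block ::
  "multiphase_opf \<Rightarrow> (nat \<Rightarrow> cmat) \<Rightarrow> (nat \<Rightarrow> nat \<Rightarrow> cmat) \<Rightarrow> (nat \<Rightarrow> nat \<Rightarrow> cmat) \<Rightarrow> nat \<Rightarrow> nat
     \<Rightarrow> complex^(phase + phase)^(phase + phase)" where
  "bfm_block P v S l i j =
     block (mat_sup (v i) (lphases P i j)) (S i j) (adj_mat (S i j)) (l i j)"

definition bfm_feasible ::
  "multiphase_opf \<Rightarrow> (nat \<Rightarrow> cvec) \<Rightarrow> (nat \<Rightarrow> cmat) \<Rightarrow> (nat \<Rightarrow> nat \<Rightarrow> cmat)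
     \<Rightarrow> (nat \<Rightarrow> nat \<Rightarrow> cmat) \<Rightarrow> bool" where
  "bfm_feasible P s v S l \<longleftrightarrow>
     (\<forall>i\<in>buses P. s i \<in> phase_vecs (bphases P i)) \<and>
     (\<forall>i\<in>buses P. v i \<in> herm_mats (bphases P i)) \<and>
     (\<forall>(i, j)\<in>lines P. S i j \<in> phase_mats (lphases P i j)) \<and>
     (\<forall>(i, j)\<in>lines P. l i j \<in> herm_mats (lphases P i j)) \<and>
     (\<forall>j\<in>buses P.
        (\<Sum>i | (i, j) \<in> lines P. diag_vec (S i j - impedance P i j ** l i j)) + s j =
        (\<Sum>k | (j, k) \<in> lines P. vec_sup (diag_vec (S j k)) (bphases P j))) \<and>
     (\<forall>i\<in>buses_pos P. s i \<in> injections P i) \<and>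
     v 0 = outer_self (V0ref P) \<and>
     voltage_bounds P v \<and>
     (\<forall>(i, j)\<in>lines P. v j =
        mat_sup (v i) (lphases P i j)
        - (S i j ** adj_mat (impedance P i j) + impedance P i j ** adj_mat (S i j))
        + impedance P i j ** l i j ** adj_mat (impedance P i j)) \<and>
     (\<forall>(i, j)\<in>lines P. psd (bfm_block P v S l i j))"

definition bfm_optimal ::
  "multiphase_opf \<Rightarrow> (nat \<Rightarrow> cvec) \<Rightarrow> (nat \<Rightarrow> cmat) \<Rightarrow> (nat \<Rightarrow> nat \<Rightarrow> cmat)
     \<Rightarrow> (nat \<Rightarrow> nat \<Rightarrow> cmat) \<Rightarrow> bool" where
  "bfm_optimal P s v S l \<longleftrightarrow>
     bfm_feasible P s v S l \<and>
     (\<forall>s' v' S' l'. bfm_feasible P s' v' S' l' \<longrightarrow> total_cost P s \<le> total_cost P s')"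

definition bfm_sdp_exact :: "multiphase_opf \<Rightarrow> bool" where
  "bfm_sdp_exact P \<longleftrightarrow>
     (\<forall>s v S l. bfm_optimal P s v S l \<longrightarrow> (\<forall>(i, j)\<in>lines P. rank (bfm_block P v S l i j) = 1))"

end

theory Submission
  imports Defs
begin

text \<open>
  On every line, \<open>S = (v - W) y\<^sup>H\<close>, \<open>l = y (v - W - W\<^sup>H + u) y\<^sup>H\<close> and
  \<open>W = v - S z\<^sup>H\<close>, where \<open>v\<close> and \<open>u\<close> belong to the near and the far end, are mutually inverse
  substitutions between the two models that leave \<open>s\<close> and \<open>v\<close> unchanged.  They turn the power
  balances into each other, and act on the \<open>2 \<times> 2\<close> blocks by the congruences with
  \<open>[1, 0; y, -y]\<close> and \<open>[1, 0; 1, -z]\<close>, so both positive semidefiniteness and rank are preserved.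
  Hence optimal solutions correspond to optimal solutions, with equal ranks on every line.
\<close>

section \<open>Matrix algebra\<close>

lemma matrix_add_rdistrib: "(A + B) ** C = A ** C + B ** C" for A :: "'a::semiring_1^'n^'m"
  by (simp add: vec_eq_iff matrix_matrix_mult_def distrib_right sum.distrib)

lemma matrix_diff_ldistrib: "A ** (B - C) = A ** B - A ** C" for A :: "'a::ring_1^'n^'m"
  by (simp add: vec_eq_iff matrix_matrix_mult_def right_diff_distrib sum_subtractf)

lemma matrix_diff_rdistrib: "(A - B) ** C = A ** C - B ** C" for A :: "'a::ring_1^'n^'m"
  by (simp add: vec_eq_iff matrix_matrix_mult_def left_diff_distrib sum_subtractf)

lemma matrix_minus_left: "(- A) ** B = - (A ** B)" for A :: "'a::ring_1^'n^'m"
  by (simp add: vec_eq_iff matrix_matrix_mult_def sum_negf)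

lemma matrix_minus_right: "A ** (- B) = - (A ** B)" for A :: "'a::ring_1^'n^'m"
  by (simp add: vec_eq_iff matrix_matrix_mult_def sum_negf)

lemma matrix_zero_left: "0 ** A = 0" for A :: "'a::ring_1^'n^'m"
  by (simp add: vec_eq_iff matrix_matrix_mult_def)

lemma matrix_zero_right: "A ** 0 = 0" for A :: "'a::ring_1^'n^'m"
  by (simp add: vec_eq_iff matrix_matrix_mult_def)

lemmas matrix_ring_simps =
  matrix_add_ldistrib matrix_add_rdistrib matrix_diff_ldistrib matrix_diff_rdistrib
  matrix_minus_left matrix_minus_right matrix_zero_left matrix_zero_right matrix_mul_assoc

lemma adj_mat_nth: "adj_mat A $ i $ j = cnj (A $ j $ i)"
  by (simp add: adj_mat_def transpose_def)

lemma adj_mat_adj_mat [simp]: "adj_mat (adj_mat A) = A"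
  by (simp add: vec_eq_iff adj_mat_nth)

lemma adj_mat_mult: "adj_mat (A ** B) = adj_mat B ** adj_mat A"
  by (simp add: vec_eq_iff adj_mat_nth matrix_matrix_mult_def mult.commute)

lemma adj_mat_add: "adj_mat (A + B) = adj_mat A + adj_mat B"
  by (simp add: vec_eq_iff adj_mat_nth)

lemma adj_mat_diff: "adj_mat (A - B) = adj_mat A - adj_mat B"
  by (simp add: vec_eq_iff adj_mat_nth)

lemma adj_mat_minus: "adj_mat (- A) = - adj_mat A"
  by (simp add: vec_eq_iff adj_mat_nth)

lemma adj_mat_zero: "adj_mat 0 = 0"
  by (simp add: vec_eq_iff adj_mat_nth)

lemma adj_mat_one: "adj_mat (mat 1) = mat 1"
  by (simp add: vec_eq_iff adj_mat_nth mat_def)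

lemmas adj_mat_simps =
  adj_mat_mult adj_mat_add adj_mat_diff adj_mat_minus adj_mat_zero adj_mat_one

section \<open>Congruence, semidefiniteness and rank\<close>

lemma hermitian_congruence:
  assumes "hermitian M"
  shows "hermitian (T ** M ** adj_mat T)"
  using assms by (simp add: hermitian_def adj_mat_mult matrix_mul_assoc)

text \<open>The form of \<open>T ** M ** adj_mat T\<close> at \<open>x\<close> is the form of
  \<open>M\<close> at \<open>adj_mat T *v x\<close>, for rectangular and singular \<open>T\<close>
  alike.\<close>

lemma psd_congruence:
  fixes T :: "complex^'n^'m"
  assumes "psd M"
  shows "psd (T ** M ** adj_mat T)"
  unfolding psd_def
proof (intro conjI allI)
  show "hermitian (T ** M ** adj_mat T)"
    using assms by (simp add: psd_def hermitian_congruence)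
next
  fix x :: "complex^'m"
  define u where "u = M *v (adj_mat T *v x)"
  have "(\<Sum>i\<in>UNIV. cnj (x $ i) * ((T ** M ** adj_mat T) *v x) $ i)
      = (\<Sum>i\<in>UNIV. cnj (x $ i) * (T *v u) $ i)"
    by (simp add: u_def matrix_vector_mul_assoc matrix_mul_assoc)
  also have "\<dots> = (\<Sum>i\<in>UNIV. \<Sum>k\<in>UNIV. cnj (x $ i) * (T $ i $ k * u $ k))"
    by (simp add: matrix_vector_mult_def sum_distrib_left)
  also have "\<dots> = (\<Sum>k\<in>UNIV. \<Sum>i\<in>UNIV. cnj (x $ i) * (T $ i $ k * u $ k))"
    by (rule sum.swap)
  also have "\<dots> = (\<Sum>k\<in>UNIV. cnj ((adj_mat T *v x) $ k) * u $ k)"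
    by (simp add: matrix_vector_mult_def adj_mat_nth sum_distrib_left mult_ac)
  finally show "0 \<le> Re (\<Sum>i\<in>UNIV. cnj (x $ i) * ((T ** M ** adj_mat T) *v x) $ i)"
    using assms by (simp add: psd_def u_def)
qed

text \<open>The library bounds the rank of a product for real matrices only.\<close>

lemma rank_mult_le_right:
  fixes A :: "'a::field^'n^'m" and B :: "'a^'k^'n"
  shows "rank (A ** B) \<le> rank B"
proof -
  have "row i (A ** B) \<in> vec.span (rows B)" for i
  proof -
    have "row i (A ** B) = (\<Sum>k\<in>UNIV. A $ i $ k *s row k B)"
      by (simp add: vec_eq_iff row_def matrix_matrix_mult_def)
    also have "\<dots> \<in> vec.span (rows B)"
      by (intro vec.span_sum vec.span_scale vec.span_base) (auto simp: rows_def)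
    finally show ?thesis .
  qed
  then have "rows (A ** B) \<subseteq> vec.span (rows B)"
    by (auto simp: rows_def)
  then show ?thesis
    unfolding row_rank_def_gen by (metis vec.dim_subset vec.dim_span)
qed

text \<open>Passing from \<open>A\<close> to \<open>A ** B\<close> applies one linear map to all
  rows, and a linear map cannot raise the dimension of a span.\<close>

lemma rank_mult_le_left:
  fixes A :: "'a::field^'n^'m" and B :: "'a^'k^'n"
  shows "rank (A ** B) \<le> rank A"
proof -
  define f where "f x = transpose B *v x" for x
  have "row i (A ** B) = f (row i A)" for i
    by (simp add: vec_eq_iff f_def row_def matrix_matrix_mult_def matrix_vector_mult_def
        transpose_def mult.commute)
  then have "rows (A ** B) = f ` rows A"
    by (auto simp: rows_def)
  moreover have "vec.dim (f ` rows A) \<le> vec.dim (rows A)"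
    unfolding f_def by (intro vec.dim_image_le matrix_vector_mul_linear_gen)
  ultimately show ?thesis
    by (simp add: row_rank_def_gen)
qed

text \<open>The congruence matrices used below may be singular, since \<open>y\<close> and
  \<open>z\<close> are padded with zeros outside the phase set. Equality of ranks therefore comes
  from two inequalities, one for each direction of the substitution.\<close>

lemma rank_congruence_le:
  fixes T :: "'a::field^'n^'m"
  shows "rank (T ** M ** U) \<le> rank M"
  using rank_mult_le_left rank_mult_le_right order_trans by blast

section \<open>Block matrices and the two congruences\<close>

lemma sum_UNIV_sum:
  "sum f (UNIV :: ('a::finite + 'b::finite) set) = (\<Sum>i\<in>UNIV. f (Inl i)) + (\<Sum>i\<in>UNIV. f (Inr i))"
  using sum.Plus[of "UNIV :: 'a set" "UNIV :: 'b set" f] by simp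

lemma block_mult:
  fixes A :: "'a::semiring_1^'n^'n"
  shows "block A B C D ** block A' B' C' D' =
    block (A ** A' + B ** C') (A ** B' + B ** D') (C ** A' + D ** C') (C ** B' + D ** D')"
  by (auto simp: vec_eq_iff matrix_matrix_mult_def block_def sum_UNIV_sum split: sum.split)

lemma adj_mat_block:
  "adj_mat (block A B C D) = block (adj_mat A) (adj_mat C) (adj_mat B) (adj_mat D)"
  by (auto simp: vec_eq_iff adj_mat_nth block_def split: sum.split)

text \<open>When the block is the outer product of the stacked end voltages \<open>(V, U)\<close>
  with itself, \<open>T\<close> sends \<open>(V, U)\<close> to \<open>(V, y (V - U))\<close>: the
  far-end voltage is traded for the line current. Hermitian \<open>v\<close> makes the lower left
  entry the adjoint of the upper right one.\<close>

lemma bfm_block_congruence: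
  fixes v W u y :: "complex^'n^'n"
  assumes "hermitian v"
  defines "T \<equiv> block (mat 1) 0 y (- y)"
  shows "block v ((v - W) ** adj_mat y) (adj_mat ((v - W) ** adj_mat y))
      (y ** (v - W - adj_mat W + u) ** adj_mat y)
    = T ** block v W (adj_mat W) u ** adj_mat T"
  using assms(1) unfolding T_def hermitian_def
  by (simp add: block_mult adj_mat_block adj_mat_simps matrix_ring_simps algebra_simps)

text \<open>The opposite trade, by Ohm's law: \<open>(V, I)\<close> goes to
  \<open>(V, V - z I)\<close>. Both identities hold for arbitrary \<open>y\<close> and
  \<open>z\<close>; that these are inverse enters only when the substitutions are composed.\<close>

lemma bim_block_congruence:
  fixes v S l z :: "complex^'n^'n"
  assumes "hermitian v"
  defines "T \<equiv> block (mat 1) 0 (mat 1) (- z)"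
  shows "block v (v - S ** adj_mat z) (adj_mat (v - S ** adj_mat z))
      (v - (S ** adj_mat z + z ** adj_mat S) + z ** l ** adj_mat z)
    = T ** block v S (adj_mat S) l ** adj_mat T"
  using assms(1) unfolding T_def hermitian_def
  by (simp add: block_mult adj_mat_block adj_mat_simps matrix_ring_simps algebra_simps)

section \<open>Matrices supported on a phase set\<close>

lemma phase_mats_add: "A \<in> phase_mats \<Phi> \<Longrightarrow> B \<in> phase_mats \<Phi> \<Longrightarrow> A + B \<in> phase_mats \<Phi>"
  by (auto simp: phase_mats_def)

lemma phase_mats_diff: "A \<in> phase_mats \<Phi> \<Longrightarrow> B \<in> phase_mats \<Phi> \<Longrightarrow> A - B \<in> phase_mats \<Phi>"
  by (auto simp: phase_mats_def)

lemma phase_mats_mult: "A \<in> phase_mats \<Phi> \<Longrightarrow> B \<in> phase_mats \<Phi> \<Longrightarrow> A ** B \<in> phase_mats \<Phi>"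
  by (auto simp: phase_mats_def matrix_matrix_mult_def)

lemma phase_mats_adj: "A \<in> phase_mats \<Phi> \<Longrightarrow> adj_mat A \<in> phase_mats \<Phi>"
  by (auto simp: phase_mats_def adj_mat_nth)

lemma mat_sup_in_phase_mats: "mat_sup A \<Phi> \<in> phase_mats \<Phi>"
  by (auto simp: phase_mats_def mat_sup_def)

lemmas phase_mats_intros =
  phase_mats_add phase_mats_diff phase_mats_mult phase_mats_adj mat_sup_in_phase_mats

lemma mat_sup_id: "A \<in> phase_mats \<Phi> \<Longrightarrow> mat_sup A \<Phi> = A"
  by (auto simp: phase_mats_def mat_sup_def vec_eq_iff)

lemma hermitian_mat_sup: "hermitian A \<Longrightarrow> hermitian (mat_sup A \<Phi>)"
  by (auto simp: hermitian_def vec_eq_iff adj_mat_nth mat_sup_def)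

lemma vec_sup_diag_id: "A \<in> phase_mats \<Phi> \<Longrightarrow> vec_sup (diag_vec A) \<Phi> = diag_vec A"
  by (auto simp: phase_mats_def vec_sup_def diag_vec_def vec_eq_iff)

lemma diag_vec_minus: "diag_vec (- A) = - diag_vec A" for A :: "'a::ab_group_add^'n^'n"
  by (simp add: diag_vec_def vec_eq_iff)

section \<open>Identity and inverse relative to a phase set\<close>

lemma phase_id_mult_left:
  assumes "A \<in> phase_mats \<Phi>"
  shows "phase_id \<Phi> ** A = A"
proof -
  have "(\<Sum>k\<in>UNIV. (if i \<in> \<Phi> \<and> k \<in> \<Phi> then mat 1 $ i $ k else 0) * A $ k $ j) = A $ i $ j" for i j
  proof -
    have "(\<Sum>k\<in>UNIV. (if i \<in> \<Phi> \<and> k \<in> \<Phi> then mat 1 $ i $ k else 0) * A $ k $ j)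
        = (\<Sum>k\<in>UNIV. if k = i then A $ i $ j else 0)"
      using assms by (intro sum.cong) (auto simp: phase_mats_def mat_def)
    then show ?thesis by simp
  qed
  then show ?thesis
    by (simp add: vec_eq_iff phase_id_def mat_sup_def matrix_matrix_mult_def)
qed

lemma adj_phase_id: "adj_mat (phase_id \<Phi>) = phase_id \<Phi>"
  by (auto simp: vec_eq_iff adj_mat_nth phase_id_def mat_sup_def mat_def)

lemma phase_id_mult_right:
  assumes "A \<in> phase_mats \<Phi>"
  shows "A ** phase_id \<Phi> = A"
proof -
  have "adj_mat (A ** phase_id \<Phi>) = adj_mat A"
    using phase_id_mult_left[OF phase_mats_adj[OF assms]] by (simp add: adj_mat_mult adj_phase_id)
  then show ?thesis by (metis adj_mat_adj_mat)
qed

text \<open>The usual \<open>B = B ** A ** C = C\<close>: the support clause of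
  \<open>is_phase_inv\<close> lets \<open>phase_id\<close> act as an identity on \<open>B\<close>
  and \<open>C\<close>. This justifies the definite description in \<open>phase_inv\<close>.\<close>

lemma is_phase_inv_unique:
  assumes "is_phase_inv \<Phi> A B" "is_phase_inv \<Phi> A C"
  shows "B = C"
  using assms unfolding is_phase_inv_def
  by (metis matrix_mul_assoc phase_id_mult_left phase_id_mult_right)

lemma is_phase_inv_phase_inv:
  assumes "phase_invertible \<Phi> A"
  shows "is_phase_inv \<Phi> A (phase_inv \<Phi> A)"
  using assms unfolding phase_invertible_def phase_inv_def
  by (metis is_phase_inv_unique theI)

text \<open>The bracketing serves rewriting. Products associate to the left, so the right-hand rules
  match the end of a product, while the left-hand ones apply after regrouping as
  \<open>z ** (y ** A)\<close>.\<close>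

lemma is_phase_inv_cancel:
  assumes "is_phase_inv \<Phi> z y" "A \<in> phase_mats \<Phi>"
  shows "z ** (y ** A) = A" "y ** (z ** A) = A"
    "A ** adj_mat y ** adj_mat z = A" "A ** adj_mat z ** adj_mat y = A"
proof -
  have "z ** y = phase_id \<Phi>" "y ** z = phase_id \<Phi>"
    using assms by (auto simp: is_phase_inv_def)
  \<comment> \<open>Adjoints reverse products and fix \<open>phase_id\<close>, so they form an
    inverse pair again.\<close>
  moreover from this have "adj_mat y ** adj_mat z = phase_id \<Phi>" "adj_mat z ** adj_mat y = phase_id \<Phi>"
    by (metis adj_mat_mult adj_phase_id)+
  ultimately show "z ** (y ** A) = A" "y ** (z ** A) = A"
    "A ** adj_mat y ** adj_mat z = A" "A ** adj_mat z ** adj_mat y = A"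
    using assms(2) by (metis matrix_mul_assoc phase_id_mult_left phase_id_mult_right)+
qed

section \<open>The correspondence on a single line\<close>

text \<open>
  The equations for \<open>W, u\<close> and those for \<open>S, l\<close> determine each other when \<open>z\<close> and \<open>y\<close> are inverse
  on \<open>\<Phi>\<close>.  Since they form a cycle, the definition must not be used as a set of rewrite rules.
\<close>

definition line_corr ::
  "phase set \<Rightarrow> cmat \<Rightarrow> cmat \<Rightarrow> cmat \<Rightarrow> cmat \<Rightarrow> cmat \<Rightarrow> cmat \<Rightarrow> cmat \<Rightarrow> bool" where
  "line_corr \<Phi> z y v u W S l \<longleftrightarrow>
     W \<in> phase_mats \<Phi> \<and> S \<in> phase_mats \<Phi> \<and> l \<in> phase_mats \<Phi> \<and>
     W = v - S ** adj_mat z \<and>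
     u = v - (S ** adj_mat z + z ** adj_mat S) + z ** l ** adj_mat z \<and>
     S = (v - W) ** adj_mat y \<and>
     l = y ** (v - W - adj_mat W + u) ** adj_mat y"

lemma line_corrD:
  assumes "line_corr \<Phi> z y v u W S l"
  shows "W \<in> phase_mats \<Phi>" "S \<in> phase_mats \<Phi>" "l \<in> phase_mats \<Phi>"
    "W = v - S ** adj_mat z"
    "u = v - (S ** adj_mat z + z ** adj_mat S) + z ** l ** adj_mat z"
    "S = (v - W) ** adj_mat y"
    "l = y ** (v - W - adj_mat W + u) ** adj_mat y"
  using assms unfolding line_corr_def by blast+

lemma line_corr_of_bim:
  assumes inv: "is_phase_inv \<Phi> z y" and v: "hermitian v"
    and mem: "v \<in> phase_mats \<Phi>" "u \<in> phase_mats \<Phi>" "W \<in> phase_mats \<Phi>"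
  shows "line_corr \<Phi> z y v u W ((v - W) ** adj_mat y) (y ** (v - W - adj_mat W + u) ** adj_mat y)"
proof -
  have y: "y \<in> phase_mats \<Phi>" using inv by (simp add: is_phase_inv_def)
  let ?X = "v - W - adj_mat W + u"
  have X: "?X \<in> phase_mats \<Phi>" and vW: "v - W \<in> phase_mats \<Phi>"
    using mem by (auto intro!: phase_mats_intros)
  \<comment> \<open>\<open>S\<close> gives back \<open>v - W\<close>, and its adjoint gives back
    \<open>v - adj_mat W\<close>.\<close>
  have 1: "(v - W) ** adj_mat y ** adj_mat z = v - W"
    by (rule is_phase_inv_cancel[OF inv vW])
  then have "adj_mat ((v - W) ** adj_mat y ** adj_mat z) = adj_mat (v - W)"
    by simp
  then have 2: "z ** adj_mat ((v - W) ** adj_mat y) = v - adj_mat W"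
    using v by (simp add: adj_mat_mult adj_mat_diff hermitian_def)
  have "z ** (y ** ?X ** adj_mat y) ** adj_mat z = z ** (y ** ?X) ** adj_mat y ** adj_mat z"
    by (simp only: matrix_mul_assoc)
  also have "\<dots> = ?X"
    by (simp only: is_phase_inv_cancel[OF inv X])
  finally have 3: "z ** (y ** ?X ** adj_mat y) ** adj_mat z = ?X" .
  \<comment> \<open>After these rewrites the equation for \<open>u\<close> reads \<open>u = v - ((v
    - W) + (v - adj_mat W)) + (v - W - adj_mat W + u)\<close>.\<close>
  show ?thesis
    unfolding line_corr_def 1 2 3
    using mem X vW y by (auto intro!: phase_mats_intros)
qed

lemma line_corr_of_bfm:
  assumes inv: "is_phase_inv \<Phi> z y" and v: "hermitian v"
    and mem: "v \<in> phase_mats \<Phi>" "z \<in> phase_mats \<Phi>" "S \<in> phase_mats \<Phi>" "l \<in> phase_mats \<Phi>"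
    and u: "u = v - (S ** adj_mat z + z ** adj_mat S) + z ** l ** adj_mat z"
  shows "line_corr \<Phi> z y v u (v - S ** adj_mat z) S l"
proof -
  have "S = (v - (v - S ** adj_mat z)) ** adj_mat y"
    by (simp add: is_phase_inv_cancel[OF inv mem(3)])
  \<comment> \<open>Inserting the voltage equation for \<open>u\<close> cancels every term linear in
    \<open>S\<close>, as well as \<open>v\<close>.\<close>
  moreover have "v - (v - S ** adj_mat z) - adj_mat (v - S ** adj_mat z) + u = z ** l ** adj_mat z"
    using v by (simp add: u hermitian_def adj_mat_simps)
  moreover have "y ** (z ** l ** adj_mat z) ** adj_mat y = l"
  proof -
    have "y ** (z ** l ** adj_mat z) ** adj_mat y = y ** (z ** l) ** adj_mat z ** adj_mat y"
      by (simp only: matrix_mul_assoc)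
    then show ?thesis by (simp only: is_phase_inv_cancel[OF inv mem(4)])
  qed
  ultimately show ?thesis
    unfolding line_corr_def
    using mem u by (metis phase_mats_diff phase_mats_mult phase_mats_adj)
qed

text \<open>Each block is a congruence image of the other, so semidefiniteness travels both ways and
  each rank bounds the other.\<close>

lemma line_corr_blocks:
  assumes "line_corr \<Phi> z y v u W S l" and "hermitian v"
  shows "psd (block v W (adj_mat W) u) \<longleftrightarrow> psd (block v S (adj_mat S) l)"
    and "rank (block v W (adj_mat W) u) = rank (block v S (adj_mat S) l)"
proof -
  obtain T where T: "block v S (adj_mat S) l = T ** block v W (adj_mat W) u ** adj_mat T"
    using bfm_block_congruence[OF assms(2)] line_corrD(6,7)[OF assms(1)] by metis
  obtain R where R: "block v W (adj_mat W) u = R ** block v S (adj_mat S) l ** adj_mat R"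
    using bim_block_congruence[OF assms(2)] line_corrD(4,5)[OF assms(1)] by metis
  show "psd (block v W (adj_mat W) u) \<longleftrightarrow> psd (block v S (adj_mat S) l)"
    by (metis T R psd_congruence)
  show "rank (block v W (adj_mat W) u) = rank (block v S (adj_mat S) l)"
    by (metis T R rank_congruence_le order_antisym)
qed

text \<open>This supplies the domain condition on \<open>l\<close>, which has no direct counterpart
  in the bus injection model; \<open>l\<close> is a congruence image of a Hermitian matrix.\<close>

lemma line_corr_hermitian:
  assumes "line_corr \<Phi> z y v u W S l" "hermitian v" "hermitian u"
  shows "hermitian l"
proof -
  have "hermitian (v - W - adj_mat W + u)"
    using assms(2,3) by (simp add: hermitian_def adj_mat_simps algebra_simps)
  then show ?thesis
    using line_corrD(7)[OF assms(1)] hermitian_congruence by metis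
qed

text \<open>
  The left-hand side is the flow that the bus injection model sends from the far end back into the
  line; the branch flow model counts the same power as received there, hence the sign.
\<close>

lemma line_corr_receiving:
  assumes "line_corr \<Phi> z y v u W S l" and inv: "is_phase_inv \<Phi> z y"
    and v: "v \<in> phase_mats \<Phi>" and u: "u \<in> phase_mats \<Phi>"
  shows "(u - adj_mat W) ** adj_mat y = - (S - z ** l)"
proof -
  let ?X = "v - W - adj_mat W + u"
  have W: "W \<in> phase_mats \<Phi>" and S: "S = (v - W) ** adj_mat y" and l: "l = y ** ?X ** adj_mat y"
    using line_corrD[OF assms(1)] by blast+
  have X: "?X \<in> phase_mats \<Phi>"
    using W v u by (auto intro!: phase_mats_intros)
  have "z ** l = z ** (y ** ?X) ** adj_mat y"
    unfolding l by (simp only: matrix_mul_assoc)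
  then have "z ** l = ?X ** adj_mat y"
    by (simp only: is_phase_inv_cancel[OF inv X])
  \<comment> \<open>The flows entering the line at its two ends add up to \<open>z ** l\<close>, the
    loss on the line.\<close>
  moreover have "?X ** adj_mat y = (v - W) ** adj_mat y + (u - adj_mat W) ** adj_mat y"
    unfolding matrix_add_rdistrib[symmetric] by (simp add: algebra_simps)
  ultimately show ?thesis
    unfolding S by simp
qed

section \<open>The correspondence on a network\<close>

lemma path_between_prefix:
  assumes "path_between N E i (xs @ k # ys) j"
  shows "path_between N E i (xs @ [k]) k"
  using assms unfolding path_between_def simple_path_def
  by (auto simp: successively_append_iff hd_append)

text \<open>A path from 0 to \<open>j\<close> passes through \<open>i\<close>. Cut at
  \<open>i\<close>, it must by the reverse line already contain \<open>j\<close>, which also ends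
  the full path: a repeated vertex. Each neighbour of a bus thus lies on either an outgoing or an
  incoming line, never both.\<close>

lemma oriented_from_root_asym:
  assumes "is_tree N E" "oriented_from_root N E" "0 \<in> N" "(i, j) \<in> E"
  shows "(j, i) \<notin> E"
proof
  assume ji: "(j, i) \<in> E"
  have ij: "i \<noteq> j" and "j \<in> N"
    using assms by (auto simp: is_tree_def)
  then obtain p where p: "path_between N E 0 p j"
    using assms(1,3) unfolding is_tree_def by blast
  then have "i \<in> set p"
    using assms by (auto simp: oriented_from_root_def)
  then obtain xs ys where xy: "p = xs @ i # ys"
    by (meson split_list)
  then have "path_between N E 0 (xs @ [i]) i"
    using p path_between_prefix by blast
  then have "j \<in> set (xs @ [i])"
    using ji assms(2) unfolding oriented_from_root_def by blast
  then have "j \<in> set xs" using ij by simp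
  moreover have "j = last (i # ys)"
    using p xy by (auto simp: path_between_def)
  then have "j \<in> set (i # ys)"
    by (metis last_in_set list.discI)
  ultimately show False
    using p xy by (auto simp: path_between_def simple_path_def)
qed

text \<open>The first conjunct fixes the reversed entry \<open>W j i\<close>, which the power
  balance at \<open>j\<close> reads and \<open>line_corr\<close> does not mention.\<close>

definition network_corr ::
  "multiphase_opf \<Rightarrow> (nat \<Rightarrow> cmat) \<Rightarrow> (nat \<Rightarrow> nat \<Rightarrow> cmat) \<Rightarrow> (nat \<Rightarrow> nat \<Rightarrow> cmat)
     \<Rightarrow> (nat \<Rightarrow> nat \<Rightarrow> cmat) \<Rightarrow> bool" where
  "network_corr P v W S l \<longleftrightarrow> (\<forall>(i, j)\<in>lines P. W j i = adj_mat (W i j) \<and>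
     line_corr (lphases P i j) (impedance P i j) (admittance P i j)
       (mat_sup (v i) (lphases P i j)) (v j) (W i j) (S i j) (l i j))"

context
  fixes P :: multiphase_opf
  assumes network: "multiphase_radial_network P"
begin

lemma lines_subset: "lines P \<subseteq> buses P \<times> buses P"
  using network by (simp add: multiphase_radial_network_def is_tree_def)

lemma lines_asym: "(i, j) \<in> lines P \<Longrightarrow> (j, i) \<notin> lines P"
  using network oriented_from_root_asym[of "buses P" "lines P" i j]
  by (simp add: multiphase_radial_network_def buses_def)

lemma finite_lines: "finite {k. (j, k) \<in> lines P}" "finite {k. (k, j) \<in> lines P}"
  by (rule finite_subset[of _ "buses P"]; use lines_subset in \<open>auto simp: buses_def\<close>)+

lemma line_data:
  assumes "(i, j) \<in> lines P"
  shows "i \<in> buses P" "j \<in> buses P"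
    "lphases P j i = lphases P i j" "bphases P j = lphases P i j"
    "lphases P i j \<subseteq> bphases P i" "admittance P j i = admittance P i j"
    "impedance P i j \<in> phase_mats (lphases P i j)"
    "is_phase_inv (lphases P i j) (impedance P i j) (admittance P i j)"
proof -
  show "i \<in> buses P" "j \<in> buses P" using assms lines_subset by auto
  have *: "lphases P i j = lphases P j i \<and> lphases P i j \<subseteq> bphases P i \<and>
        lphases P i j = bphases P j \<and> impedance P i j = impedance P j i \<and>
        impedance P i j \<in> phase_mats (lphases P i j) \<and>
        phase_invertible (lphases P i j) (impedance P i j)"
    using network assms unfolding multiphase_radial_network_def by fast
  show "lphases P j i = lphases P i j" "bphases P j = lphases P i j"
    "lphases P i j \<subseteq> bphases P i" "impedance P i j \<in> phase_mats (lphases P i j)"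
    using * by auto
  show "admittance P j i = admittance P i j"
    using * by (simp add: admittance_def)
  show "is_phase_inv (lphases P i j) (impedance P i j) (admittance P i j)"
    using * is_phase_inv_phase_inv unfolding admittance_def by blast
qed

lemma line_voltages:
  assumes "(i, j) \<in> lines P" and "\<forall>i\<in>buses P. v i \<in> herm_mats (bphases P i)"
  shows "hermitian (mat_sup (v i) (lphases P i j))" "hermitian (v j)"
    "v j \<in> phase_mats (lphases P i j)"
proof -
  have "v i \<in> herm_mats (bphases P i)" "v j \<in> herm_mats (lphases P i j)"
    using assms line_data[OF assms(1)] by metis+
  then show "hermitian (mat_sup (v i) (lphases P i j))" "hermitian (v j)"
    "v j \<in> phase_mats (lphases P i j)"
    by (auto simp: herm_mats_def hermitian_mat_sup)
qed

section \<open>Partners of feasible points, and their power balances\<close>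

lemma network_corr_of_bim:
  assumes "bim_feasible P s v W"
  shows "\<exists>S l. network_corr P v W S l"
proof -
  define S where "S i j = (mat_sup (v i) (lphases P i j) - W i j) ** adj_mat (admittance P i j)" for i j
  define l where "l i j = admittance P i j **
    (mat_sup (v i) (lphases P i j) - W i j - adj_mat (W i j) + v j) ** adj_mat (admittance P i j)" for i j
  have v: "\<forall>i\<in>buses P. v i \<in> herm_mats (bphases P i)"
    using assms by (simp add: bim_feasible_def)
  have "network_corr P v W S l"
    unfolding network_corr_def S_def l_def
  proof (safe intro!: line_corr_of_bim)
    fix i j assume e: "(i, j) \<in> lines P"
    note line_voltages[OF e v, simp] line_data[OF e, simp]
    have "W i j = adj_mat (W j i)"
      using assms e by (auto simp: bim_feasible_def)
    then show "W j i = adj_mat (W i j)" by simp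
    show "W i j \<in> phase_mats (lphases P i j)"
      using assms e by (auto simp: bim_feasible_def adjacent_def)
    show "is_phase_inv (lphases P i j) (impedance P i j) (admittance P i j)"
      "hermitian (mat_sup (v i) (lphases P i j))" "v j \<in> phase_mats (lphases P i j)"
      "mat_sup (v i) (lphases P i j) \<in> phase_mats (lphases P i j)"
      by (simp_all add: mat_sup_in_phase_mats)
  qed
  then show ?thesis by blast
qed

lemma network_corr_of_bfm:
  assumes "bfm_feasible P s v S l"
  shows "\<exists>W. network_corr P v W S l"
proof -
  define X where "X i j = mat_sup (v i) (lphases P i j) - S i j ** adj_mat (impedance P i j)" for i j
  \<comment> \<open>\<open>W\<close> needs values in both directions of a line; by
    \<open>lines_asym\<close> the reversed pair falls into the second case.\<close>
  define W where "W i j = (if (i, j) \<in> lines P then X i j else adj_mat (X j i))" for i j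
  have v: "\<forall>i\<in>buses P. v i \<in> herm_mats (bphases P i)"
    using assms by (simp add: bfm_feasible_def)
  have "W j i = adj_mat (W i j) \<and> line_corr (lphases P i j) (impedance P i j) (admittance P i j)
       (mat_sup (v i) (lphases P i j)) (v j) (W i j) (S i j) (l i j)" if e: "(i, j) \<in> lines P" for i j
  proof
    show "W j i = adj_mat (W i j)"
      using e lines_asym by (simp add: W_def)
    have "line_corr (lphases P i j) (impedance P i j) (admittance P i j)
       (mat_sup (v i) (lphases P i j)) (v j) (X i j) (S i j) (l i j)"
      unfolding X_def
    proof (rule line_corr_of_bfm)
      show "is_phase_inv (lphases P i j) (impedance P i j) (admittance P i j)"
        "impedance P i j \<in> phase_mats (lphases P i j)"
        using line_data[OF e] by simp_all
      show "hermitian (mat_sup (v i) (lphases P i j))"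
        using line_voltages[OF e v] by simp
    qed (use assms e in \<open>auto simp: bfm_feasible_def herm_mats_def mat_sup_in_phase_mats\<close>)
    then show "line_corr (lphases P i j) (impedance P i j) (admittance P i j)
       (mat_sup (v i) (lphases P i j)) (v j) (W i j) (S i j) (l i j)"
      using e by (simp add: W_def)
  qed
  then show ?thesis by (auto simp: network_corr_def)
qed

text \<open>The neighbours of \<open>j\<close> split into outgoing lines, whose terms are the flows
  \<open>S j k\<close>, and incoming lines, whose terms are given by
  \<open>line_corr_receiving\<close>.\<close>

lemma network_corr_injection:
  assumes corr: "network_corr P v W S l" and v: "\<forall>i\<in>buses P. v i \<in> herm_mats (bphases P i)"
  shows "(\<Sum>k | adjacent (lines P) j k.
        vec_sup (diag_vec ((mat_sup (v j) (lphases P j k) - W j k) ** adj_mat (admittance P j k)))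
          (bphases P j))
    = (\<Sum>k | (j, k) \<in> lines P. vec_sup (diag_vec (S j k)) (bphases P j))
      - (\<Sum>i | (i, j) \<in> lines P. diag_vec (S i j - impedance P i j ** l i j))"
    (is "sum ?f _ = _")
proof -
  have "{k. adjacent (lines P) j k} = {k. (j, k) \<in> lines P} \<union> {k. (k, j) \<in> lines P}"
    by (auto simp: adjacent_def)
  moreover have "{k. (j, k) \<in> lines P} \<inter> {k. (k, j) \<in> lines P} = {}"
    using lines_asym by blast
  ultimately have "(\<Sum>k | adjacent (lines P) j k. ?f k)
      = (\<Sum>k | (j, k) \<in> lines P. ?f k) + (\<Sum>k | (k, j) \<in> lines P. ?f k)"
    by (simp add: sum.union_disjoint finite_lines)
  moreover have "?f k = vec_sup (diag_vec (S j k)) (bphases P j)" if "(j, k) \<in> lines P" for k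
  proof -
    have "S j k = (mat_sup (v j) (lphases P j k) - W j k) ** adj_mat (admittance P j k)"
      using corr that line_corrD(6) unfolding network_corr_def by fast
    then show ?thesis by simp
  qed
  moreover have "?f i = - diag_vec (S i j - impedance P i j ** l i j)" if e: "(i, j) \<in> lines P" for i
  proof -
    note d = line_data[OF e] and h = line_voltages[OF e v]
    have c: "W j i = adj_mat (W i j)"
      "line_corr (lphases P i j) (impedance P i j) (admittance P i j)
         (mat_sup (v i) (lphases P i j)) (v j) (W i j) (S i j) (l i j)"
      using corr e by (auto simp: network_corr_def)
    have "(v j - adj_mat (W i j)) ** adj_mat (admittance P i j)
        = - (S i j - impedance P i j ** l i j)"
      by (rule line_corr_receiving[OF c(2) d(8) mat_sup_in_phase_mats h(3)])
    moreover have "S i j - impedance P i j ** l i j \<in> phase_mats (lphases P i j)"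
      using line_corrD(2,3)[OF c(2)] d(7) by (auto intro!: phase_mats_intros)
    then have "- (S i j - impedance P i j ** l i j) \<in> phase_mats (lphases P i j)"
      by (simp add: phase_mats_def)
    \<comment> \<open>At the far end of a line, bus and line have the same phases, so
      \<open>mat_sup\<close> and \<open>vec_sup\<close> act as identities here.\<close>
    ultimately show ?thesis
      using d h c by (simp only: mat_sup_id vec_sup_diag_id flip: diag_vec_minus)
  qed
  ultimately show ?thesis
    by (simp add: sum_negf)
qed

section \<open>Blocks, feasibility and optimality\<close>

lemma network_corr_blocks:
  assumes corr: "network_corr P v W S l" and v: "\<forall>i\<in>buses P. v i \<in> herm_mats (bphases P i)"
    and e: "(i, j) \<in> lines P"
  shows "psd (bim_block P v W i j) \<longleftrightarrow> psd (bfm_block P v S l i j)"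
    and "rank (bim_block P v W i j) = rank (bfm_block P v S l i j)"
proof -
  have c: "W j i = adj_mat (W i j)"
    "line_corr (lphases P i j) (impedance P i j) (admittance P i j)
       (mat_sup (v i) (lphases P i j)) (v j) (W i j) (S i j) (l i j)"
    using corr e by (auto simp: network_corr_def)
  show "psd (bim_block P v W i j) \<longleftrightarrow> psd (bfm_block P v S l i j)"
    and "rank (bim_block P v W i j) = rank (bfm_block P v S l i j)"
    using line_corr_blocks[OF c(2) line_voltages(1)[OF e v]]
    by (simp_all add: bim_block_def bfm_block_def c(1))
qed

text \<open>For Hermitian \<open>v\<close> of the right support, the correspondence forces the
  constraints on \<open>W\<close> alone and those on \<open>S\<close> and \<open>l\<close> alone, as
  well as the voltage equation; balance and semidefiniteness translate, and the rest is shared. For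
  any other \<open>v\<close> both sides fail.\<close>

lemma network_corr_feasible:
  assumes corr: "network_corr P v W S l"
  shows "bim_feasible P s v W \<longleftrightarrow> bfm_feasible P s v S l"
proof (cases "\<forall>i\<in>buses P. v i \<in> herm_mats (bphases P i)")
  case True
  have c: "W j i = adj_mat (W i j)"
    "line_corr (lphases P i j) (impedance P i j) (admittance P i j)
       (mat_sup (v i) (lphases P i j)) (v j) (W i j) (S i j) (l i j)" if "(i, j) \<in> lines P" for i j
    using corr that by (auto simp: network_corr_def)
  have "W i j \<in> phase_mats (lphases P i j)" "W j i \<in> phase_mats (lphases P j i)"
    if "(i, j) \<in> lines P" for i j
    using c(1)[OF that] line_corrD(1)[OF c(2)[OF that]] line_data(3)[OF that]
    by (simp_all add: phase_mats_adj)
  then have W: "\<forall>i j. adjacent (lines P) i j \<longrightarrow> W i j \<in> phase_mats (lphases P i j)"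
    unfolding adjacent_def by blast
  have W_adj: "\<forall>(i, j)\<in>lines P. W i j = adj_mat (W j i)"
    using c(1) by auto
  have S: "\<forall>(i, j)\<in>lines P. S i j \<in> phase_mats (lphases P i j)"
    using line_corrD(2)[OF c(2)] by blast
  have l: "\<forall>(i, j)\<in>lines P. l i j \<in> herm_mats (lphases P i j)"
    using line_corr_hermitian[OF c(2) line_voltages(1,2)[OF _ True]]
      line_corrD(3)[OF c(2)]
    by (auto simp: herm_mats_def)
  have v: "\<forall>(i, j)\<in>lines P. v j = mat_sup (v i) (lphases P i j)
        - (S i j ** adj_mat (impedance P i j) + impedance P i j ** adj_mat (S i j))
        + impedance P i j ** l i j ** adj_mat (impedance P i j)"
    using line_corrD(5)[OF c(2)] by blast
  have psd: "(\<forall>(i, j)\<in>lines P. psd (bim_block P v W i j)) \<longleftrightarrow>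
      (\<forall>(i, j)\<in>lines P. psd (bfm_block P v S l i j))"
    using network_corr_blocks(1)[OF corr True] by auto
  have eq: "x = a - b \<longleftrightarrow> b + x = a" for a b x :: cvec
    by (auto simp: algebra_simps)
  \<comment> \<open>\<open>eqTrueI\<close> replaces each forced constraint as a whole by
    \<open>True\<close>; the equations inside never act as rewrite rules.\<close>
  show ?thesis
    unfolding bim_feasible_def bfm_feasible_def network_corr_injection[OF corr True] eq
    by (simp only: W[THEN eqTrueI] W_adj[THEN eqTrueI] S[THEN eqTrueI] l[THEN eqTrueI]
        v[THEN eqTrueI] psd True[THEN eqTrueI] simp_thms)
next
  case False
  then show ?thesis unfolding bim_feasible_def bfm_feasible_def by blast
qed

text \<open>Competitors need partners too: every feasible point of either model has one with the
  same \<open>s\<close>, hence the same cost, so both models compare against the same set of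
  costs.\<close>

lemma network_corr_optimal:
  assumes "network_corr P v W S l"
  shows "bim_optimal P s v W \<longleftrightarrow> bfm_optimal P s v S l"
  unfolding bim_optimal_def bfm_optimal_def network_corr_feasible[OF assms]
  using network_corr_of_bim network_corr_of_bfm network_corr_feasible by metis

text \<open>Exactness speaks of all optimal points, so each direction starts from an optimum of the
  model in its conclusion, passes to an optimal partner in the other, and carries the rank
  back.\<close>

lemma exactness_equivalence: "bim_sdp_exact P \<longleftrightarrow> bfm_sdp_exact P"
proof
  assume exact: "bim_sdp_exact P"
  show "bfm_sdp_exact P"
    unfolding bfm_sdp_exact_def
  proof (intro allI impI)
    fix s v S l assume opt: "bfm_optimal P s v S l"
    then have v: "\<forall>i\<in>buses P. v i \<in> herm_mats (bphases P i)"
      by (simp add: bfm_optimal_def bfm_feasible_def)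
    obtain W where corr: "network_corr P v W S l"
      using opt network_corr_of_bfm unfolding bfm_optimal_def by blast
    then show "\<forall>(i, j)\<in>lines P. rank (bfm_block P v S l i j) = 1"
      using exact opt network_corr_optimal network_corr_blocks(2)[OF corr v]
      by (fastforce simp: bim_sdp_exact_def)
  qed
next
  assume exact: "bfm_sdp_exact P"
  show "bim_sdp_exact P"
    unfolding bim_sdp_exact_def
  proof (intro allI impI)
    fix s v W assume opt: "bim_optimal P s v W"
    then have v: "\<forall>i\<in>buses P. v i \<in> herm_mats (bphases P i)"
      by (simp add: bim_optimal_def bim_feasible_def)
    obtain S l where corr: "network_corr P v W S l"
      using opt network_corr_of_bim unfolding bim_optimal_def by blast
    then show "\<forall>(i, j)\<in>lines P. rank (bim_block P v W i j) = 1"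
      using exact opt network_corr_optimal network_corr_blocks(2)[OF corr v]
      by (fastforce simp: bfm_sdp_exact_def)
  qed
qed

end

theorem corollary2:
  fixes P :: multiphase_opf
  assumes "multiphase_radial_network P"
    and "opf_data P"
  shows "bim_sdp_exact P \<longleftrightarrow> bfm_sdp_exact P"
  using exactness_equivalence[OF assms(1)] .

end
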